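(* Let $n \ge 1$, let $p(1),\ldots,p(n)$ be numbers with $0 < p(i) < 1$, and let $A(1),\ldots,A(n)$ be independent events on a probability space $(\Omega, B, \mathbf{P})$ with $\mathbf{P}(A(i)) = p(i)$. Put $\zeta(i) = I(A(i)) - p(i)$, where $I(A(i))$ is the indicator function of $A(i)$, and $$S(n) = \sum_{i=1}^n \zeta(i), \qquad W(n) = \sqrt{\sum_{i=1}^n Q(p(i))^2}.$$ Then for all $x \ge 0$, $$\max\left[\mathbf{P}(S(n) > x),\ \mathbf{P}(S(n) < -x)\right] \le \exp\left(-\frac{x^2}{4 W^2(n)}\right).$$
   Context: The function $Q:[0,1]\to[0,\infty)$ is the non-negative continuous function given by $$Q(p) = \sqrt{\frac{1-2p}{4\ln((1-p)/p)}}$$ for $p \in (0,1)$, $p \ne 1/2$, and extended by continuity: $Q(0) = Q(1) = 0$ and $Q(1/2)^2 = 1/8$. *)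

theory Defs
  imports "HOL-Probability.Probability" "HOL-Real_Asymp.Real_Asymp"
begin

text \<open>
  Only the values on the interval \<open>[0, 1]\<close> are meaningful. The values at \<open>0\<close>, \<open>1/2\<close> and \<open>1\<close> are
  the continuous extension of the last expression, see \<open>continuous_on_Q\<close>.
\<close>

definition Q :: "real \<Rightarrow> real" where
  "Q p = (if p = 0 \<or> p = 1 then 0
          else if p = 1 / 2 then sqrt (1 / 8)
          else sqrt ((1 - 2 * p) / (4 * ln ((1 - p) / p))))"

definition zeta :: "(nat \<Rightarrow> 'a set) \<Rightarrow> (nat \<Rightarrow> real) \<Rightarrow> nat \<Rightarrow> 'a \<Rightarrow> real" where
  "zeta A p i \<omega> = indicator (A i) \<omega> - p i"

definition S :: "(nat \<Rightarrow> 'a set) \<Rightarrow> (nat \<Rightarrow> real) \<Rightarrow> nat \<Rightarrow> 'a \<Rightarrow> real" where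
  "S A p n \<omega> = (\<Sum>i = 1..n. zeta A p i \<omega>)"

definition W :: "(nat \<Rightarrow> real) \<Rightarrow> nat \<Rightarrow> real" where
  "W p n = sqrt (\<Sum>i = 1..n. (Q (p i))\<^sup>2)"

lemma continuous_on_Q: "continuous_on {0..1} Q"
proof (rule continuous_on_eq_continuous_within[THEN iffD2], rule ballI)
  define f :: "real \<Rightarrow> real" where "f = (\<lambda>p. sqrt ((1 - 2 * p) / (4 * ln ((1 - p) / p))))"
  have Q_f: "Q p = f p" if "p \<noteq> 0" "p \<noteq> 1" "p \<noteq> 1 / 2" for p
    using that by (simp add: Q_def f_def)
  have Q_values: "Q 0 = 0" "Q 1 = 0" "Q (1 / 2) = sqrt (1 / 8)"
    by (simp_all add: Q_def)
  have lims: "(f \<longlongrightarrow> 0) (at_right 0)" "(f \<longlongrightarrow> 0) (at_left 1)" "(f \<longlongrightarrow> sqrt (1 / 8)) (at (1 / 2))"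
    unfolding f_def by (real_asymp simp: powr_half_sqrt)+
  fix q :: real assume q: "q \<in> {0..1}"
  consider "q = 0" | "q = 1" | "q = 1 / 2" | "q \<in> {0<..<1}" "q \<noteq> 1 / 2"
    using q by fastforce
  then show "continuous (at q within {0..1}) Q"
  proof cases
    case 1
    have "\<forall>\<^sub>F p in at_right 0. f p = Q p"
      by (auto simp: eventually_at_right_field Q_f intro!: exI[of _ "1 / 2"])
    from Lim_transform_eventually[OF lims(1) this] show ?thesis
      by (simp add: 1 continuous_within Q_values at_within_Icc_at_right)
  next
    case 2
    have "\<forall>\<^sub>F p in at_left 1. f p = Q p"
      by (auto simp: eventually_at_left_field Q_f intro!: exI[of _ "1 / 2"])
    from Lim_transform_eventually[OF lims(2) this] show ?thesis
      by (simp add: 2 continuous_within Q_values at_within_Icc_at_left)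
  next
    case 3
    have "\<forall>\<^sub>F p in at (1 / 2). f p = Q p"
      unfolding eventually_at
      by (rule exI[of _ "1 / 2"]) (auto simp: dist_real_def abs_if intro!: Q_f[symmetric] split: if_splits)
    from Lim_transform_eventually[OF lims(3) this] have "isCont Q (1 / 2)"
      by (simp add: continuous_within Q_values)
    then show ?thesis
      using 3 continuous_at_imp_continuous_at_within by blast
  next
    case 4
    have "(1 - q) / q \<noteq> 1" "(1 - q) / q > 0" using 4 by (auto simp: field_simps)
    then have "isCont f q"
      unfolding f_def using 4 by (intro continuous_intros) auto
    moreover have "\<forall>\<^sub>F p in nhds q. Q p = f p"
      by (rule eventually_nhds_in_open[of "{0<..<1} - {1 / 2}", THEN eventually_mono])
         (use 4 in \<open>auto intro: Q_f\<close>)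
    ultimately have "isCont Q q"
      using isCont_cong by blast
    then show ?thesis
      using continuous_at_imp_continuous_at_within by blast
  qed
qed

end

theory Submission
  imports Defs
begin

text \<open>
  Write \<open>p = p i\<close> and \<open>a = ln ((1 - p) / p) / 2\<close>. Then \<open>p\<close> and \<open>1 - p\<close> are proportional to
  \<open>exp (- a)\<close> and \<open>exp a\<close>, so that \<open>1 - 2 * p = tanh a\<close> and \<open>Q p ^ 2 = tanh a / (8 * a)\<close>, and the
  moment generating function of a centred Bernoulli variable is
  \<open>exp (t / 2 * tanh a) * cosh (t / 2 - a) / cosh a\<close>. The Kearns--Saul inequality, which bounds it
  by \<open>exp (t ^ 2 * Q p ^ 2)\<close>, thereby becomes
    \<open>ln (cosh u) - ln (cosh a) \<le> tanh a / (2 * a) * (u ^ 2 - a ^ 2)\<close> with \<open>u = t / 2 - a\<close>.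
  This says that \<open>ln (cosh (sqrt v))\<close>, as a function of \<open>v\<close>, lies below its tangent at \<open>v = a ^ 2\<close>,
  and it does because its derivative \<open>tanh (sqrt v) / (2 * sqrt v)\<close> is decreasing, which in turn
  follows from the concavity of \<open>tanh\<close> on the non-negative half-line
  (\<open>cosh_le_exp_tanh_slope\<close>). For \<open>p = 1 / 2\<close>, that is \<open>a = 0\<close>, the quotient \<open>tanh a / a\<close> stands
  for its limit \<open>1\<close>.

  By independence, the moment generating function of \<open>S A p n\<close> at \<open>t\<close> is at most
  \<open>exp (t ^ 2 * (W p n) ^ 2)\<close> for every real \<open>t\<close>. Chernoff's bound at
  \<open>t = x / (2 * (W p n) ^ 2)\<close> gives the upper tail, and the same bound at \<open>- t\<close> the lower tail.
\<close>

section \<open>A Gaussian bound for the hyperbolic cosine\<close>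

text \<open>The value at \<open>0\<close> is the limit of the quotient. It is what makes the symmetric case
  \<open>p = 1 / 2\<close> an instance of the general one.\<close>

definition tanh_slope :: "real \<Rightarrow> real" where
  "tanh_slope a = (if a = 0 then 1 else tanh a / a)"

lemma tanh_slope_mult: "tanh_slope a * a = tanh a"
  by (simp add: tanh_slope_def)

lemma tanh_slope_abs: "tanh_slope \<bar>a\<bar> = tanh_slope a"
  by (simp add: tanh_slope_def abs_if)

lemma tanh_slope_pos: "tanh_slope a > 0"
  by (cases a "0 :: real" rule: linorder_cases)
     (auto simp: tanh_slope_def intro: divide_neg_neg)

lemma concave_tanh: "concave_on {0..} (tanh :: real \<Rightarrow> real)"
  unfolding concave_on_def
proof (rule convex_on_realI)
  fix x y :: real assume "x \<in> {0..}" "y \<in> {0..}" "x \<le> y"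
  then show "(tanh x)\<^sup>2 - 1 \<le> (tanh y)\<^sup>2 - 1"
    by (simp add: power_mono)
qed (auto intro!: derivative_eq_intros)

text \<open>A chord of a concave function through the origin loses slope as its other end moves to the
  right; the tangent at the origin, of slope \<open>1\<close>, is the limiting case.\<close>

lemma tanh_le_tanh_slope_mult:
  fixes a u :: real
  assumes "0 \<le> a" "a \<le> u"
  shows "tanh u \<le> tanh_slope a * u"
proof (cases "a = 0")
  case True
  have "0 - tanh 0 \<le> u - tanh u"
  proof (rule DERIV_nonneg_imp_nondecreasing[where f = "\<lambda>x. x - tanh x"])
    fix x :: real
    have "((\<lambda>x. x - tanh x) has_real_derivative (tanh x)\<^sup>2) (at x)"
      by (auto intro!: derivative_eq_intros)
    then show "\<exists>y. ((\<lambda>x. x - tanh x) has_real_derivative y) (at x) \<and> 0 \<le> y"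
      by auto
  qed (use assms in simp)
  with True show ?thesis by (simp add: tanh_slope_def)
next
  case False
  with assms have pos: "0 < a" "0 < u" by auto
  have "(1 - a / u) * tanh 0 + a / u * tanh u \<le> tanh ((1 - a / u) *\<^sub>R 0 + (a / u) *\<^sub>R u)"
    using assms pos by (intro concave_onD[OF concave_tanh]) auto
  with pos show ?thesis by (simp add: tanh_slope_def field_simps)
qed

lemma tanh_slope_mult_le_tanh:
  fixes a u :: real
  assumes "0 \<le> u" "u \<le> a"
  shows "tanh_slope a * u \<le> tanh u"
proof (cases "u = 0")
  case False
  with assms have pos: "0 < u" "0 < a" by auto
  have "tanh_slope a * u = tanh a * u / a"
    using pos by (simp add: tanh_slope_def)
  also have "\<dots> \<le> tanh_slope u * a * u / a"
    using pos assms tanh_le_tanh_slope_mult[of u a] by (intro divide_right_mono mult_right_mono) auto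
  also have "\<dots> = tanh u"
    using pos by (simp add: tanh_slope_def)
  finally show ?thesis .
qed simp

text \<open>The difference \<open>tanh_slope a * u ^ 2 / 2 - ln (cosh u)\<close> has derivative
  \<open>tanh_slope a * u - tanh u\<close>, which changes sign from minus to plus at \<open>u = a\<close>. Hence its minimum
  over the non-negative half-line is attained there, and both sides are even in \<open>u\<close> and in \<open>a\<close>.\<close>

lemma cosh_le_exp_tanh_slope:
  fixes a u :: real
  shows "cosh u \<le> cosh a * exp (tanh_slope a * (u\<^sup>2 - a\<^sup>2) / 2)"
proof -
  have nonneg: "cosh u \<le> cosh a * exp (tanh_slope a * (u\<^sup>2 - a\<^sup>2) / 2)"
    if "0 \<le> a" "0 \<le> u" for a u :: real
  proof -
    define h where "h = (\<lambda>u. tanh_slope a * u\<^sup>2 / 2 - ln (cosh u))"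
    have deriv: "(h has_real_derivative (tanh_slope a * u - tanh u)) (at u)" for u
      unfolding h_def by (auto intro!: derivative_eq_intros simp: tanh_def)
    have "h a \<le> h u"
    proof (cases "a \<le> u")
      case True
      show ?thesis
      proof (rule DERIV_nonneg_imp_nondecreasing[where f = h, OF True])
        fix y assume "a \<le> y" "y \<le> u"
        with that show "\<exists>d. (h has_real_derivative d) (at y) \<and> 0 \<le> d"
          using deriv tanh_le_tanh_slope_mult[of a y] by fastforce
      qed
    next
      case False
      show ?thesis
      proof (rule DERIV_nonpos_imp_nonincreasing[where f = h])
        fix y assume "u \<le> y" "y \<le> a"
        with that show "\<exists>d. (h has_real_derivative d) (at y) \<and> d \<le> 0"
          using deriv tanh_slope_mult_le_tanh[of y a] by fastforce
      qed (use False in simp)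
    qed
    then have "ln (cosh u) \<le> ln (cosh a) + tanh_slope a * (u\<^sup>2 - a\<^sup>2) / 2"
      by (simp add: h_def field_simps)
    then have "exp (ln (cosh u)) \<le> exp (ln (cosh a) + tanh_slope a * (u\<^sup>2 - a\<^sup>2) / 2)"
      by (simp only: exp_le_cancel_iff)
    then show ?thesis by (simp add: exp_add)
  qed
  show ?thesis using nonneg[of "\<bar>a\<bar>" "\<bar>u\<bar>"] by (simp add: tanh_slope_abs)
qed

section \<open>The Kearns--Saul inequality\<close>

definition half_log_odds_against :: "real \<Rightarrow> real" where
  "half_log_odds_against p = ln ((1 - p) / p) / 2"

lemma half_log_odds_against_eq_0_iff:
  assumes "0 < p" "p < 1"
  shows "half_log_odds_against p = 0 \<longleftrightarrow> p = 1 / 2"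
  using assms by (auto simp: half_log_odds_against_def field_simps)

lemma
  assumes "0 < p" "p < 1"
  shows prob_eq_half_log_odds_against: "p = exp (- half_log_odds_against p) / (2 * cosh (half_log_odds_against p))"
    and compl_prob_eq_half_log_odds_against: "1 - p = exp (half_log_odds_against p) / (2 * cosh (half_log_odds_against p))"
    and tanh_half_log_odds_against: "tanh (half_log_odds_against p) = 1 - 2 * p"
proof -
  define a where "a = half_log_odds_against p"
  have "exp a * exp a = (1 - p) / p"
    using assms by (simp add: a_def half_log_odds_against_def flip: exp_add)
  then have eq: "p * exp a = (1 - p) * exp (- a)"
    using assms by (simp add: exp_minus field_simps)
  have two_cosh: "2 * cosh a = exp a + exp (- a)"
    by (simp add: cosh_field_def)
  have "p * (2 * cosh a) = exp (- a)"
    unfolding two_cosh using eq by (simp add: algebra_simps)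
  then show p: "p = exp (- a) / (2 * cosh a)"
    by (simp add: field_simps)
  have "(1 - p) * (2 * cosh a) = exp a"
    unfolding two_cosh using eq by (simp add: algebra_simps)
  then show q: "1 - p = exp a / (2 * cosh a)"
    by (simp add: field_simps)
  have "tanh a = (exp a - exp (- a)) / (2 * cosh a)"
    by (simp add: tanh_def sinh_field_def)
  also have "\<dots> = (1 - p) - p"
    by (simp only: diff_divide_distrib flip: p q)
  finally show "tanh a = 1 - 2 * p" by simp
qed

lemma Q_squared:
  assumes "0 < p" "p < 1"
  shows "(Q p)\<^sup>2 = tanh_slope (half_log_odds_against p) / 8"
proof (cases "p = 1 / 2")
  case True
  then show ?thesis by (simp add: Q_def tanh_slope_def half_log_odds_against_def)
next
  case False
  have "(1 - 2 * p) / (4 * ln ((1 - p) / p)) = tanh_slope (half_log_odds_against p) / 8"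
    using False assms tanh_half_log_odds_against[OF assms]
    by (simp add: tanh_slope_def half_log_odds_against_eq_0_iff) (simp add: half_log_odds_against_def)
  then have "Q p = sqrt (tanh_slope (half_log_odds_against p) / 8)"
    using False assms by (simp add: Q_def)
  then show ?thesis
    using tanh_slope_pos[of "half_log_odds_against p"] by simp
qed

lemma Q_squared_pos: "0 < p \<Longrightarrow> p < 1 \<Longrightarrow> 0 < (Q p)\<^sup>2"
  by (simp add: Q_squared tanh_slope_pos)

lemma Kearns_Saul:
  fixes p t :: real
  assumes "0 < p" "p < 1"
  shows "p * exp (t * (1 - p)) + (1 - p) * exp (- t * p) \<le> exp (t\<^sup>2 * (Q p)\<^sup>2)"
proof -
  define a where "a = half_log_odds_against p"
  have tanh_a: "tanh a = 1 - 2 * p"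
    using tanh_half_log_odds_against[OF assms] by (simp add: a_def)
  have "p * exp (t * (1 - p)) + (1 - p) * exp (- t * p)
      = exp (- a) / (2 * cosh a) * exp (t * (1 - p)) + exp a / (2 * cosh a) * exp (- t * p)"
    by (simp only: a_def flip: prob_eq_half_log_odds_against[OF assms] compl_prob_eq_half_log_odds_against[OF assms])
  also have "\<dots> = (exp (- a) * exp (t * (1 - p)) + exp a * exp (- t * p)) / (2 * cosh a)"
    by (simp add: add_divide_distrib)
  also have "exp (- a) * exp (t * (1 - p)) + exp a * exp (- t * p)
      = exp (t / 2 * tanh a) * (2 * cosh (t / 2 - a))"
  proof -
    have "- a + t * (1 - p) = t / 2 * tanh a + (t / 2 - a)"
      and "a + - t * p = t / 2 * tanh a + - (t / 2 - a)"
      by (simp_all add: tanh_a field_simps)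
    moreover have "2 * cosh (t / 2 - a) = exp (t / 2 - a) + exp (- (t / 2 - a))"
      by (simp add: cosh_field_def)
    ultimately show ?thesis
      by (simp only: distrib_left flip: exp_add)
  qed
  also have "exp (t / 2 * tanh a) * (2 * cosh (t / 2 - a)) / (2 * cosh a)
      \<le> exp (t / 2 * tanh a) * (2 * (cosh a * exp (tanh_slope a * ((t / 2 - a)\<^sup>2 - a\<^sup>2) / 2)))
          / (2 * cosh a)"
    by (intro divide_right_mono mult_left_mono cosh_le_exp_tanh_slope) auto
  also have "\<dots> = exp (t / 2 * tanh a + tanh_slope a * ((t / 2 - a)\<^sup>2 - a\<^sup>2) / 2)"
    by (simp add: exp_add)
  \<comment> \<open>The terms linear in \<open>t\<close> cancel because the comparison is tangent at \<open>t = 0\<close> and the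
    variable is centred.\<close>
  also have "t / 2 * tanh a + tanh_slope a * ((t / 2 - a)\<^sup>2 - a\<^sup>2) / 2 = t\<^sup>2 * (Q p)\<^sup>2"
    unfolding Q_squared[OF assms] a_def[symmetric] tanh_slope_mult[of a, symmetric]
    by (simp add: power2_eq_square field_simps)
  finally show ?thesis .
qed

section \<open>Tails of sums of independent centred indicators\<close>

context prob_space
begin

text \<open>A single event is closed under intersection, so independence of the events passes to the
  \<open>\<sigma>\<close>-algebras that they generate, and the indicator of an event is measurable for its own
  \<open>\<sigma>\<close>-algebra.\<close>

lemma indep_vars_indicator:
  assumes "indep_events A I"
  shows "indep_vars (\<lambda>_. borel) (\<lambda>i. indicator (A i) :: 'a \<Rightarrow> real) I"
  unfolding indep_vars_def2
proof (intro conjI ballI)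
  have A: "A i \<in> events" if "i \<in> I" for i
    using assms that by (auto simp: indep_events_def)
  then show "random_variable borel (indicator (A i) :: 'a \<Rightarrow> real)" if "i \<in> I" for i
    using that by simp
  have "indep_sets (\<lambda>i. sigma_sets (space M) {A i}) I"
    using assms by (intro indep_sets_sigma) (auto simp: indep_events_def_alt Int_stable_def)
  then show "indep_sets (\<lambda>i. {(indicator (A i) :: 'a \<Rightarrow> real) -` B \<inter> space M | B. B \<in> sets borel}) I"
  proof (rule indep_sets_mono_sets)
    fix i assume i: "i \<in> I"
    have sub: "{A i} \<subseteq> Pow (space M)"
      using A[OF i] sets.sets_into_space by auto
    have "(indicator (A i) :: 'a \<Rightarrow> real) \<in> borel_measurable (sigma (space M) {A i})"
      using sub by (intro borel_measurable_indicator) auto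
    from measurable_sets[OF this]
    show "{(indicator (A i) :: 'a \<Rightarrow> real) -` B \<inter> space M | B. B \<in> sets borel}
        \<subseteq> sigma_sets (space M) {A i}"
      using sub by auto
  qed
qed

lemma nn_integral_exp_centred_indicator:
  fixes t p :: real
  assumes [measurable]: "B \<in> events" and "0 < p" "p < 1" "prob B = p"
  shows "(\<integral>\<^sup>+\<omega>. ennreal (exp (t * (indicator B \<omega> - p))) \<partial>M) \<le> ennreal (exp (t\<^sup>2 * (Q p)\<^sup>2))"
proof -
  have eq: "exp (t * (indicator B \<omega> - p))
      = exp (- t * p) + (exp (t * (1 - p)) - exp (- t * p)) * indicator B \<omega>" for \<omega>
    by (auto simp: indicator_def)
  have int: "integrable M (\<lambda>\<omega>. exp (t * (indicator B \<omega> - p)))"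
    unfolding eq by (auto simp: less_top[symmetric])
  have "expectation (\<lambda>\<omega>. exp (t * (indicator B \<omega> - p)))
      = exp (- t * p) + (exp (t * (1 - p)) - exp (- t * p)) * p"
    unfolding eq using assms(4)
    by (subst Bochner_Integration.integral_add) (auto simp: prob_space less_top[symmetric])
  also have "\<dots> = p * exp (t * (1 - p)) + (1 - p) * exp (- t * p)"
    by (simp add: algebra_simps)
  also have "\<dots> \<le> exp (t\<^sup>2 * (Q p)\<^sup>2)"
    by (rule Kearns_Saul) fact+
  finally show ?thesis
    using int by (subst nn_integral_eq_integral) (auto intro: ennreal_leI)
qed

text \<open>Allowing every real \<open>t\<close>, not only \<open>t \<ge> 0\<close>, lets the same bound control the variable
  \<open>- S A p n\<close>, and hence the lower tail.\<close>

lemma nn_integral_exp_S: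
  fixes t :: real
  assumes p: "\<And>i. i \<in> {1..n} \<Longrightarrow> 0 < p i \<and> p i < 1"
    and indep: "indep_events A {1..n}"
    and prob_A: "\<And>i. i \<in> {1..n} \<Longrightarrow> prob (A i) = p i"
  shows "(\<integral>\<^sup>+\<omega>. ennreal (exp (t * S A p n \<omega>)) \<partial>M) \<le> ennreal (exp (t\<^sup>2 * (W p n)\<^sup>2))"
proof -
  have A: "A i \<in> events" if "i \<in> {1..n}" for i
    using indep that by (auto simp: indep_events_def)
  have "(\<integral>\<^sup>+\<omega>. ennreal (exp (t * S A p n \<omega>)) \<partial>M)
      = (\<integral>\<^sup>+\<omega>. (\<Prod>i\<in>{1..n}. ennreal (exp (t * (indicator (A i) \<omega> - p i)))) \<partial>M)"
    by (simp add: S_def zeta_def sum_distrib_left exp_sum prod_ennreal)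
  also have "\<dots> = (\<Prod>i\<in>{1..n}. \<integral>\<^sup>+\<omega>. ennreal (exp (t * (indicator (A i) \<omega> - p i))) \<partial>M)"
    by (intro indep_vars_nn_integral indep_vars_compose2[OF indep_vars_indicator[OF indep]]) auto
  also have "\<dots> \<le> (\<Prod>i\<in>{1..n}. ennreal (exp (t\<^sup>2 * (Q (p i))\<^sup>2)))"
    using p A prob_A by (intro prod_mono_ennreal nn_integral_exp_centred_indicator) auto
  also have "\<dots> = ennreal (exp (t\<^sup>2 * (W p n)\<^sup>2))"
    by (simp add: W_def sum_nonneg sum_distrib_left exp_sum prod_ennreal)
  finally show ?thesis .
qed

text \<open>The exponent \<open>t ^ 2 * w - t * x\<close> that Chernoff's bound produces is smallest at
  \<open>t = x / (2 * w)\<close>.\<close>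

lemma sub_Gaussian_tail:
  fixes X :: "'a \<Rightarrow> real" and w x :: real
  assumes [measurable]: "random_variable borel X"
    and mgf: "\<And>t. (\<integral>\<^sup>+\<omega>. ennreal (exp (t * X \<omega>)) \<partial>M) \<le> ennreal (exp (t\<^sup>2 * w))"
    and "w > 0" "x \<ge> 0"
  shows "prob {\<omega> \<in> space M. X \<omega> > x} \<le> exp (- (x\<^sup>2 / (4 * w)))"
proof (cases "x = 0")
  case True
  then show ?thesis by simp
next
  case False
  define t where "t = x / (2 * w)"
  have t: "t > 0" using False assms by (simp add: t_def)
  have "ennreal (prob {\<omega> \<in> space M. X \<omega> > x}) \<le> ennreal (prob {\<omega> \<in> space M. X \<omega> \<ge> x})"
    by (intro ennreal_leI finite_measure_mono) auto
  also have "\<dots> = emeasure M {\<omega> \<in> space M. X \<omega> \<ge> x}"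
    by (simp add: emeasure_eq_measure)
  also have "\<dots> \<le> ennreal (exp (- t * x)) * (\<integral>\<^sup>+\<omega>\<in>space M. ennreal (exp (t * X \<omega>)) \<partial>M)"
    by (intro Chernoff_ineq_nn_integral_ge t) auto
  also have "(\<integral>\<^sup>+\<omega>\<in>space M. ennreal (exp (t * X \<omega>)) \<partial>M) = (\<integral>\<^sup>+\<omega>. ennreal (exp (t * X \<omega>)) \<partial>M)"
    by (intro nn_integral_cong) simp
  also have "ennreal (exp (- t * x)) * \<dots> \<le> ennreal (exp (- t * x)) * ennreal (exp (t\<^sup>2 * w))"
    by (intro mult_left_mono mgf) auto
  also have "\<dots> = ennreal (exp (- t * x + t\<^sup>2 * w))"
    by (simp flip: ennreal_mult exp_add)
  also have "- t * x + t\<^sup>2 * w = - (x\<^sup>2 / (4 * w))"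
    using \<open>w > 0\<close> by (simp add: t_def field_simps power2_eq_square)
  finally show ?thesis by simp
qed

end

theorem proposition3p1:
  fixes M :: "'a measure"
    and A :: "nat \<Rightarrow> 'a set"
    and p :: "nat \<Rightarrow> real"
    and n :: nat
    and x :: real
  assumes "n \<ge> 1"
    and "\<And>i. i \<in> {1..n} \<Longrightarrow> 0 < p i \<and> p i < 1"
    and "prob_space M"
    and "prob_space.indep_events M A {1..n}"
    and "\<And>i. i \<in> {1..n} \<Longrightarrow> measure M (A i) = p i"
    and "x \<ge> 0"
  shows "max (measure M {\<omega> \<in> space M. S A p n \<omega> > x})
             (measure M {\<omega> \<in> space M. S A p n \<omega> < - x})
         \<le> exp (- (x\<^sup>2 / (4 * (W p n)\<^sup>2)))"
proof -
  interpret prob_space M by fact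
  have [measurable]: "A i \<in> events" if "i \<in> {1..n}" for i
    using assms(4) that by (auto simp: indep_events_def)
  have [measurable]: "random_variable borel (S A p n)"
    unfolding S_def zeta_def by measurable
  have "0 < (\<Sum>i = 1..n. (Q (p i))\<^sup>2)"
    using assms(1,2) by (intro sum_pos Q_squared_pos) auto
  then have W_pos: "0 < (W p n)\<^sup>2"
    by (simp add: W_def)
  note mgf = nn_integral_exp_S[OF assms(2,4,5)]
  have "prob {\<omega> \<in> space M. S A p n \<omega> > x} \<le> exp (- (x\<^sup>2 / (4 * (W p n)\<^sup>2)))"
    by (rule sub_Gaussian_tail) (use mgf W_pos assms(6) in auto)
  moreover have "prob {\<omega> \<in> space M. - S A p n \<omega> > x} \<le> exp (- (x\<^sup>2 / (4 * (W p n)\<^sup>2)))"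
  proof (rule sub_Gaussian_tail)
    show "(\<integral>\<^sup>+\<omega>. ennreal (exp (t * - S A p n \<omega>)) \<partial>M) \<le> ennreal (exp (t\<^sup>2 * (W p n)\<^sup>2))" for t
      using mgf[of "- t"] by simp
  qed (use W_pos assms(6) in auto)
  moreover have "{\<omega> \<in> space M. - S A p n \<omega> > x} = {\<omega> \<in> space M. S A p n \<omega> < - x}"
    by auto
  ultimately show ?thesis by simp
qed

end
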